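(* Let $k \in \mathbb{N}$, $m \in \mathbb{N}_{>0}$, and let $\mathcal{E}_1,\dots,\mathcal{E}_m$ be i.i.d. random variables having the standard exponential distribution (density $e^{-x}$ on $[0,+\infty)$). (i) For every integer $r > 1$, $$r^k\,\mathcal{M}_r(k,m) \le \left(\frac{r}{r-1}\right)^{2k}\mathbb{E}\left[(\mathcal{E}_1+\dots+\mathcal{E}_m)^k\right] = \left(\frac{r}{r-1}\right)^{2k}\frac{(m-1+k)!}{(m-1)!}.$$ (ii) The following limit holds, as $r$ tends to infinity through the integers: $$\lim_{r\to+\infty} r^k\,\mathcal{M}_r(k,m) = \mathbb{E}\left[(\mathcal{E}_1+\dots+\mathcal{E}_m)^k\right] = \frac{(m-1+k)!}{(m-1)!}.$$
   Context: $\mathbb{N}$ denotes the nonnegative integers and $\mathbb{N}_{>0}$ the positive integers. For $r \in \mathbb{N}_{>0}$, the beta distribution with parameters $(1,r)$ is the probability distribution on $\mathbb{R}$ with density $g_r(x) = r(1-x)^{r-1}$ if $x \in [0,1]$ and $g_r(x) = 0$ otherwise (with $0^0=1$). For $k \in \mathbb{N}$ and $m \in \mathbb{N}_{>0}$, define $$\mathcal{M}_r(k,m) = \mathbb{E}\left[(X_1+\dots+X_m)^k\right],$$ where $X_1,\dots,X_m$ are independent random variables each having the beta$(1,r)$ distribution. *)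

theory Defs
  imports "HOL-Probability.Probability"
begin

definition beta_density :: "nat \<Rightarrow> real \<Rightarrow> real" where
  "beta_density r x = (if x \<in> {0..1} then real r * (1 - x) ^ (r - 1) else 0)"

definition beta_distribution :: "nat \<Rightarrow> real measure" where
  "beta_distribution r = density lborel (\<lambda>x. ennreal (beta_density r x))"

text \<open>
  The independent variables are realised as the coordinates of the product space; by
  \<open>beta_moment_eq_expectation\<close> below, any other choice gives the same value. Meant for
  \<open>r > 0\<close> and \<open>m > 0\<close>.
\<close>

definition beta_moment :: "nat \<Rightarrow> nat \<Rightarrow> nat \<Rightarrow> real" where
  "beta_moment r k m =
     (\<integral>x. (\<Sum>i\<in>{1..m}. x i) ^ k \<partial>(\<Pi>\<^sub>M i\<in>{1..m}. beta_distribution r))"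

lemma beta_density_measurable [measurable]: "beta_density r \<in> borel_measurable borel"
  unfolding beta_density_def by measurable

lemma prob_space_beta_distribution:
  assumes "r > 0"
  shows "prob_space (beta_distribution r)"
proof
  have "(\<integral>\<^sup>+x. ennreal (real r * (1 - x) ^ (r - 1)) * indicator {0..1} x \<partial>lborel)
        = ennreal ((\<lambda>x::real. - ((1 - x) ^ r)) 1 - (\<lambda>x. - ((1 - x) ^ r)) 0)"
    by (rule nn_integral_FTC_Icc) (auto intro!: derivative_eq_intros)
  also have "\<dots> = 1"
    using assms by simp
  also have "(\<integral>\<^sup>+x. ennreal (real r * (1 - x) ^ (r - 1)) * indicator {0..1} x \<partial>lborel)
      = (\<integral>\<^sup>+x. ennreal (beta_density r x) \<partial>lborel)"
    by (intro nn_integral_cong) (auto simp: beta_density_def indicator_def)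
  finally show "emeasure (beta_distribution r) (space (beta_distribution r)) = 1"
    by (simp add: beta_distribution_def emeasure_density)
qed

lemma beta_moment_eq_expectation:
  assumes "prob_space P" and "m > 0"
    and indep: "prob_space.indep_vars P (\<lambda>_. borel) X {1..m}"
    and distr: "\<And>i. i \<in> {1..m} \<Longrightarrow> distributed P lborel (X i) (beta_density r)"
  shows "beta_moment r k m = prob_space.expectation P (\<lambda>\<omega>. (\<Sum>i\<in>{1..m}. X i \<omega>) ^ k)"
proof -
  interpret prob_space P by fact
  have rv [measurable]: "random_variable borel (X i)" if "i \<in> {1..m}" for i
    using distributed_measurable[OF distr[OF that]] by simp
  have D: "distr P borel (X i) = beta_distribution r" if "i \<in> {1..m}" for i
  proof -
    have "distr P borel (X i) = distr P lborel (X i)"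
      by (intro distr_cong) auto
    thus ?thesis
      using distributed_distr_eq_density[OF distr[OF that]] by (simp add: beta_distribution_def)
  qed
  have "(\<Pi>\<^sub>M i\<in>{1..m}. beta_distribution r) = (\<Pi>\<^sub>M i\<in>{1..m}. distr P borel (X i))"
    by (intro PiM_cong) (simp_all add: D)
  also have "\<dots> = distr P (\<Pi>\<^sub>M i\<in>{1..m}. borel) (\<lambda>\<omega>. \<lambda>i\<in>{1..m}. X i \<omega>)"
    using indep \<open>m > 0\<close> by (subst (asm) indep_vars_iff_distr_eq_PiM') (auto simp: rv)
  finally show ?thesis
    unfolding beta_moment_def by (simp add: integral_distr)
qed

end

theory Submission
  imports Defs "HOL-Real_Asymp.Real_Asymp"
begin

text \<open>
  Dividing the \<open>j\<close>-th moment by \<open>j!\<close> turns sums of independent variables into products of formal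
  power series, so the normalised \<open>k\<close>-th moment of a sum of \<open>m\<close> i.i.d.\ variables is the \<open>k\<close>-th
  coefficient of the \<open>m\<close>-th power of one series. For a standard exponential variable all
  normalised moments are \<open>1\<close>; for \<open>r\<close> times a beta\<open>(1,r)\<close> variable they are
  \<open>r\<^sup>j / ((r+1) \<cdots> (r+j))\<close>, which is at most \<open>1\<close> and tends to \<open>1\<close>. Coefficients of powers are
  monotone in nonnegative coefficients and continuous, which gives both claims; the bound even
  holds without the factor \<open>(r/(r-1))\<^sup>2\<^sup>k\<close>.
\<close>

text \<open>Nonnegativity is proved together with the comparison because the induction multiplies
  inequalities inside the Cauchy product.\<close>

lemma fps_power_nth_mono:
  fixes a b :: "nat \<Rightarrow> 'a::linordered_idom"
  assumes "\<And>j. 0 \<le> a j" "\<And>j. a j \<le> b j"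
  shows "0 \<le> fps_nth (Abs_fps a ^ n) k \<and> fps_nth (Abs_fps a ^ n) k \<le> fps_nth (Abs_fps b ^ n) k"
proof (induction n arbitrary: k)
  case (Suc n)
  have "0 \<le> b j" for j
    using assms order_trans by blast
  with Suc assms show ?case
    by (auto simp: fps_mult_nth intro!: sum_nonneg sum_mono mult_mono)
qed auto

text \<open>Each coefficient of a power is a polynomial in finitely many coefficients of the series,
  so convergence for each \<open>j\<close> separately suffices.\<close>

lemma tendsto_fps_power_nth:
  fixes a :: "'b \<Rightarrow> nat \<Rightarrow> real"
  assumes "\<And>j. ((\<lambda>x. a x j) \<longlongrightarrow> b j) F"
  shows "((\<lambda>x. fps_nth (Abs_fps (a x) ^ n) k) \<longlongrightarrow> fps_nth (Abs_fps b ^ n) k) F"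
proof (induction n arbitrary: k)
  case (Suc n)
  then show ?case
    by (auto simp: fps_mult_nth intro!: tendsto_intros assms)
qed auto

text \<open>The binomial theorem expands the power of \<open>X i + S\<close>, independence factors
  each mixed moment, and (k choose j) j! (k-j)! = k! leaves a Cauchy product. Using
  \<open>has_bochner_integral\<close> carries integrability through the induction.\<close>

lemma (in prob_space) moment_sum_indep_vars:
  fixes X :: "'i \<Rightarrow> 'a \<Rightarrow> real"
  assumes "finite I" "indep_vars (\<lambda>_. borel) X I"
    and "\<And>i j. i \<in> I \<Longrightarrow> has_bochner_integral M (\<lambda>\<omega>. X i \<omega> ^ j) (fact j * a j)"
  shows "has_bochner_integral M (\<lambda>\<omega>. (\<Sum>i\<in>I. X i \<omega>) ^ k) (fact k * fps_nth (Abs_fps a ^ card I) k)"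
  using assms
proof (induction I arbitrary: k rule: finite_induct)
  case empty
  have "has_bochner_integral M (\<lambda>\<omega>. 0 ^ k :: real) (0 ^ k)"
    by (simp add: has_bochner_integral_iff prob_space)
  then show ?case
    by (cases k) auto
next
  case (insert i I)
  define S where "S = (\<lambda>\<omega>. \<Sum>i\<in>I. X i \<omega>)"
  define s where "s = (\<lambda>j. fps_nth (Abs_fps a ^ card I) j)"
  have S: "has_bochner_integral M (\<lambda>\<omega>. S \<omega> ^ j) (fact j * s j)" for j
    unfolding S_def s_def using insert indep_vars_subset by blast
  have ind: "indep_var borel (X i) borel S"
    unfolding S_def using insert by (intro indep_vars_sum) auto
  have prod: "has_bochner_integral M (\<lambda>\<omega>. X i \<omega> ^ j * S \<omega> ^ l) (fact j * a j * (fact l * s l))" for j l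
  proof -
    have X: "has_bochner_integral M (\<lambda>\<omega>. X i \<omega> ^ j) (fact j * a j)"
      using insert by blast
    have "indep_var borel ((\<lambda>x. x ^ j) \<circ> X i) borel ((\<lambda>x. x ^ l) \<circ> S)"
      by (rule indep_var_compose[OF ind]) auto
    then have "indep_var borel (\<lambda>\<omega>. X i \<omega> ^ j) borel (\<lambda>\<omega>. S \<omega> ^ l)"
      by (simp add: comp_def)
    from indep_var_integrable[OF this] indep_var_lebesgue_integral[OF this] X S[of l]
    show ?thesis
      by (simp add: has_bochner_integral_iff)
  qed
  have "has_bochner_integral M (\<lambda>\<omega>. \<Sum>j\<le>k. real (k choose j) * (X i \<omega> ^ j * S \<omega> ^ (k - j)))
      (\<Sum>j\<le>k. real (k choose j) * (fact j * a j * (fact (k - j) * s (k - j))))"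
    by (intro has_bochner_integral_sum has_bochner_integral_mult_right prod)
  also have "(\<Sum>j\<le>k. real (k choose j) * (fact j * a j * (fact (k - j) * s (k - j))))
      = (\<Sum>j\<le>k. fact k * (a j * s (k - j)))"
    by (intro sum.cong refl) (simp add: binomial_fact field_simps)
  also have "\<dots> = fact k * fps_nth (Abs_fps a ^ card (insert i I)) k"
    using insert by (simp add: fps_mult_nth s_def sum_distrib_left atLeast0AtMost)
  also have "(\<lambda>\<omega>. \<Sum>j\<le>k. real (k choose j) * (X i \<omega> ^ j * S \<omega> ^ (k - j)))
      = (\<lambda>\<omega>. (\<Sum>i\<in>insert i I. X i \<omega>) ^ k)"
    using insert by (simp add: binomial_ring S_def mult.assoc)
  finally show ?case .
qed

text \<open>Restriction to \<open>I\<close> is the identity on the product space, so the joint law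
  of the coordinates is the product of their marginals.\<close>

lemma indep_vars_PiM_coordinates:
  assumes "\<And>i. i \<in> I \<Longrightarrow> prob_space (M i)" "I \<noteq> {}"
  shows "prob_space.indep_vars (PiM I M) M (\<lambda>i x. x i) I"
proof -
  interpret prob_space "PiM I M"
    by (rule prob_space_PiM) fact
  have "distr (PiM I M) (PiM I M) (\<lambda>x. \<lambda>i\<in>I. x i) = distr (PiM I M) (PiM I M) (\<lambda>x. x)"
    by (intro distr_cong) (auto simp: space_PiM)
  also have "\<dots> = PiM I (\<lambda>i. distr (PiM I M) (M i) (\<lambda>x. x i))"
    using assms by (auto simp: distr_PiM_component cong: PiM_cong)
  finally show ?thesis
    using assms by (subst indep_vars_iff_distr_eq_PiM') auto
qed

lemma has_integral_Beta_nat: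
  "((\<lambda>x::real. x ^ j * (1 - x) ^ n) has_integral fact j * fact n / fact (j + n + 1)) {0..1}"
proof -
  \<comment> \<open>The endpoints are dropped because \<open>powr\<close> and \<open>^\<close> can
    differ there: \<open>0 powr 0 = 0\<close>, whereas \<open>0 ^ 0 = 1\<close>.\<close>
  have "((\<lambda>x. x powr (real (Suc j) - 1) * (1 - x) powr (real (Suc n) - 1)) has_integral
          Beta (real (Suc j)) (real (Suc n))) {0<..<1}"
    using has_integral_Beta_real[of "real (Suc j)" "real (Suc n)"] by (simp add: has_integral_Icc_iff_Ioo)
  also have "?this \<longleftrightarrow> ((\<lambda>x. x ^ j * (1 - x) ^ n) has_integral Beta (real (Suc j)) (real (Suc n))) {0<..<1}"
    by (intro has_integral_cong) (auto simp: powr_realpow)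
  also have "Beta (real (Suc j)) (real (Suc n)) = fact j * fact n / fact (j + n + 1)"
    using Gamma_fact[of j, where 'a = real] Gamma_fact[of n, where 'a = real]
      Gamma_fact[of "j + n + 1", where 'a = real]
    by (simp add: Beta_def add_ac)
  finally show ?thesis
    by (simp add: has_integral_Icc_iff_Ioo)
qed

text \<open>Integrability comes from continuity on a compact interval, the value from the gauge
  integral above with \<open>n = r - 1\<close>; uniqueness of the gauge integral joins the two. The
  factor r of the density turns (r-1)! into r!.\<close>

lemma beta_distribution_moment:
  assumes "r > 0"
  shows "has_bochner_integral (beta_distribution r) (\<lambda>x. x ^ j) (fact j * fact r / fact (r + j))"
proof -
  define f where "f = (\<lambda>x::real. if x \<in> {0..1} then real r * (x ^ j * (1 - x) ^ (r - 1)) else 0)"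
  have "integrable lborel (\<lambda>x::real. indicator {0..1} x *\<^sub>R (real r * (x ^ j * (1 - x) ^ (r - 1))))"
    by (intro borel_integrable_compact continuous_intros) auto
  also have "(\<lambda>x. indicator {0..1} x *\<^sub>R (real r * (x ^ j * (1 - x) ^ (r - 1)))) = f"
    by (auto simp: f_def)
  finally have int: "integrable lborel f" .
  have "((\<lambda>x. real r * (x ^ j * (1 - x) ^ (r - 1))) has_integral
      real r * (fact j * fact (r - 1) / fact (j + (r - 1) + 1))) {0..1}"
    by (intro has_integral_mult_right has_integral_Beta_nat)
  also have "real r * (fact j * fact (r - 1) / fact (j + (r - 1) + 1)) = fact j * fact r / fact (r + j)"
    using assms by (simp add: fact_reduce[of r] add_ac)
  finally have "(f has_integral fact j * fact r / fact (r + j)) UNIV"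
    unfolding f_def by (simp only: has_integral_restrict_UNIV)
  with has_integral_integral_lborel[OF int] have "integral\<^sup>L lborel f = fact j * fact r / fact (r + j)"
    by (rule has_integral_unique)
  with int have "has_bochner_integral lborel f (fact j * fact r / fact (r + j))"
    by (simp add: has_bochner_integral_iff)
  moreover have "f = (\<lambda>x. beta_density r x *\<^sub>R x ^ j)"
    by (auto simp: f_def beta_density_def fun_eq_iff)
  ultimately show ?thesis
    unfolding beta_distribution_def
    by (intro has_bochner_integral_density) (auto simp: beta_density_def)
qed

lemma fact_add_eq_prod: "fact (r + j) = (fact r * (\<Prod>i=1..j. of_nat (r + i)) :: 'a::{comm_semiring_1,semiring_char_0})"
  by (induction j) (auto simp: algebra_simps)

text \<open>The scaling by r is moved into each variable. Writing the normalised moments as products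
  of factors r/(r+i) suits both uses: each factor is at most 1 and tends to 1.\<close>

lemma scaled_beta_moment_eq:
  assumes "r > 0" "m > 0"
  shows "real r ^ k * beta_moment r k m
    = fact k * fps_nth (Abs_fps (\<lambda>j. \<Prod>i=1..j. real r / real (r + i)) ^ m) k"
proof -
  let ?P = "\<Pi>\<^sub>M i\<in>{1..m}. beta_distribution r"
  note prob = prob_space_beta_distribution[OF \<open>r > 0\<close>]
  interpret prob_space ?P
    by (rule prob_space_PiM) (rule prob)
  have [measurable_cong]: "sets (beta_distribution r) = sets borel"
    by (simp add: beta_distribution_def)
  have "indep_vars (\<lambda>_. borel) (\<lambda>i x. real r * x i) {1..m}"
    using assms by (intro indep_vars_compose2[OF indep_vars_PiM_coordinates] prob) auto
  moreover have "has_bochner_integral ?P (\<lambda>x. (real r * x i) ^ j)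
      (fact j * (\<Prod>i=1..j. real r / real (r + i)))" if "i \<in> {1..m}" for i j
  proof -
    have "has_bochner_integral (beta_distribution r) (\<lambda>x. (real r * x) ^ j)
        (real r ^ j * (fact j * fact r / fact (r + j)))"
      unfolding power_mult_distrib using assms
      by (intro has_bochner_integral_mult_right beta_distribution_moment)
    \<comment> \<open>The one-variable moment passes to the coordinate \<open>x i\<close> because
      the beta law is its marginal.\<close>
    also have "beta_distribution r = distr ?P (beta_distribution r) (\<lambda>x. x i)"
      using that prob by (intro distr_PiM_component[symmetric]) auto
    also have "real r ^ j * (fact j * fact r / fact (r + j)) = fact j * (\<Prod>i=1..j. real r / real (r + i))"
      by (simp add: fact_add_eq_prod prod_dividef)
    finally show ?thesis
      using that by (simp add: has_bochner_integral_iff integral_distr integrable_distr_eq)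
  qed
  ultimately have "has_bochner_integral ?P (\<lambda>x. (\<Sum>i\<in>{1..m}. real r * x i) ^ k)
      (fact k * fps_nth (Abs_fps (\<lambda>j. \<Prod>i=1..j. real r / real (r + i)) ^ card {1..m}) k)"
    by (intro moment_sum_indep_vars) auto
  then show ?thesis
    by (simp add: beta_moment_def power_mult_distrib has_bochner_integral_iff flip: sum_distrib_left)
qed

theorem proposition3p3:
  fixes P :: "'a measure" and \<E> :: "nat \<Rightarrow> 'a \<Rightarrow> real" and k m :: nat
  assumes "m > 0"
    and "prob_space P"
    and "prob_space.indep_vars P (\<lambda>_. borel) \<E> {1..m}"
    and "\<And>i. i \<in> {1..m} \<Longrightarrow> distributed P lborel (\<E> i) (exponential_density 1)"
  shows "(\<forall>r::nat. r > 1 \<longrightarrow>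
        real r ^ k * beta_moment r k m
          \<le> (real r / (real r - 1)) ^ (2 * k)
              * prob_space.expectation P (\<lambda>\<omega>. (\<Sum>i\<in>{1..m}. \<E> i \<omega>) ^ k) \<and>
        (real r / (real r - 1)) ^ (2 * k)
              * prob_space.expectation P (\<lambda>\<omega>. (\<Sum>i\<in>{1..m}. \<E> i \<omega>) ^ k)
          = (real r / (real r - 1)) ^ (2 * k) * (fact (m - 1 + k) / fact (m - 1))) \<and>
    ((\<lambda>r::nat. real r ^ k * beta_moment r k m)
        \<longlonglongrightarrow> prob_space.expectation P (\<lambda>\<omega>. (\<Sum>i\<in>{1..m}. \<E> i \<omega>) ^ k)) \<and>
    prob_space.expectation P (\<lambda>\<omega>. (\<Sum>i\<in>{1..m}. \<E> i \<omega>) ^ k)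
      = fact (m - 1 + k) / fact (m - 1)"
proof -
  interpret prob_space P by fact
  let ?E = "expectation (\<lambda>\<omega>. (\<Sum>i\<in>{1..m}. \<E> i \<omega>) ^ k)"
  let ?b = "\<lambda>r j. \<Prod>i=1..j. real r / real (r + i)"
  \<comment> \<open>The sum of m standard exponentials is Erlang with shape index
    \<open>m - 1\<close>.\<close>
  have E: "?E = fact (m - 1 + k) / fact (m - 1)"
    using erlang_ith_moment[OF _ exponential_distributed_sum[of "{1..m}" 1 \<E>], of k] assms by simp
  \<comment> \<open>A second expression for \<open>?E\<close>, as a power series coefficient, makes
    it comparable with the beta moments.\<close>
  have "has_bochner_integral P (\<lambda>\<omega>. \<E> i \<omega> ^ j) (fact j * 1)" if "i \<in> {1..m}" for i j
    using has_bochner_integral_erlang_ith_moment[OF _ assms(4)[OF that], of j] by simp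
  from moment_sum_indep_vars[OF _ assms(3) this, of k]
  have E_fps: "?E = fact k * fps_nth (Abs_fps (\<lambda>_. 1) ^ m) k"
    by (simp add: has_bochner_integral_iff)

  have bound: "real r ^ k * beta_moment r k m \<le> (real r / (real r - 1)) ^ (2 * k) * ?E" if "r > 1" for r
  proof -
    have "fps_nth (Abs_fps (?b r) ^ m) k \<le> fps_nth (Abs_fps (\<lambda>_. 1) ^ m) k"
      by (intro conjunct2[OF fps_power_nth_mono] prod_nonneg prod_le_1) auto
    then have "real r ^ k * beta_moment r k m \<le> 1 * ?E"
      using that assms(1) unfolding E_fps by (simp add: scaled_beta_moment_eq)
    also have "\<dots> \<le> (real r / (real r - 1)) ^ (2 * k) * ?E"
      \<comment> \<open>The closed form shows that \<open>?E\<close> is nonnegative, and r/(r-1) is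
        at least 1.\<close>
      unfolding E using that by (intro mult_right_mono one_le_power) auto
    finally show ?thesis .
  qed

  have "(\<lambda>r. real r / real (r + i)) \<longlonglongrightarrow> 1" for i
    by real_asymp
  then have "(\<lambda>r. ?b r j) \<longlonglongrightarrow> (\<Prod>i=1..j. 1)" for j
    by (rule tendsto_prod)
  then have "(\<lambda>r. fact k * fps_nth (Abs_fps (?b r) ^ m) k) \<longlonglongrightarrow> ?E"
    unfolding E_fps by (intro tendsto_intros tendsto_fps_power_nth) simp
  \<comment> \<open>The coefficient formula assumes \<open>r > 0\<close>, hence equality only
    eventually.\<close>
  moreover have "\<forall>\<^sub>F r in sequentially. fact k * fps_nth (Abs_fps (?b r) ^ m) k = real r ^ k * beta_moment r k m"
    using eventually_gt_at_top[of 0] by eventually_elim (simp add: scaled_beta_moment_eq assms(1))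
  ultimately have "(\<lambda>r. real r ^ k * beta_moment r k m) \<longlonglongrightarrow> ?E"
    by (rule Lim_transform_eventually)
  with bound E show ?thesis
    by simp
qed

end
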